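(* Let $(\mathcal{X},\wp)$ be a partial metric space, let $\mathcal{D}$ be a non-empty set, and for each $n\in\mathbb{N}$ let $f_n:\mathcal{D}\to\mathcal{X}$ be a function. If the sequence $\{f_n\}_{n\in\mathbb{N}}$ is statistically uniformly convergent to a function $f:\mathcal{D}\to\mathcal{X}$ on $\mathcal{D}$, then it is equi-statistically convergent to $f$ on $\mathcal{D}$.
   Context: A partial metric on a non-empty set $\mathcal{X}$ is a map $\wp:\mathcal{X}\times\mathcal{X}\to\mathbb{R}$ such that for all $x,y,z\in\mathcal{X}$: (1) $x=y$ if and only if $\wp(x,x)=\wp(x,y)=\wp(y,y)$; (2) $0\le \wp(x,x)\le\wp(x,y)$; (3) $\wp(x,y)=\wp(y,x)$; (4) $\wp(x,y)\le\wp(x,z)+\wp(z,y)-\wp(z,z)$. The pair $(\mathcal{X},\wp)$ is called a partial metric space. For $\mathcal{A}\subset\mathbb{N}$ and $j\in\mathbb{N}$ let $d_j(\mathcal{A})=|\mathcal{A}\cap\{1,\dots,j\}|/j$ (the $j$-th partial density); the natural density of $\mathcal{A}$ is $d(\mathcal{A})=\lim_{j\to\infty}d_j(\mathcal{A})$ when this limit exists. A sequence of functions $f_n:\mathcal{D}\to\mathcal{X}$ is statistically uniformly convergent to $f:\mathcal{D}\to\mathcal{X}$ on $\mathcal{D}$ if for each $\epsilon>0$ there exists $\mathcal{A}=\mathcal{A}(\epsilon)\subset\mathbb{N}$ with $d(\mathcal{A})=0$ such that for all $n\in\mathbb{N}\setminus\mathcal{A}$ and all $x\in\mathcal{D}$,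 $|\wp(f_n(x),f(x))-\wp(f(x),f(x))|<\epsilon$ and $|\wp(f_n(x),f_n(x))-\wp(f(x),f(x))|<\epsilon$. The sequence $\{f_n\}$ is equi-statistically convergent to $f$ on $\mathcal{D}$ if for each $\epsilon>0$ the sequences $\{F_{j,\epsilon}\}_{j\in\mathbb{N}}$ and $\{H_{j,\epsilon}\}_{j\in\mathbb{N}}$ of real-valued functions on $\mathcal{D}$ converge uniformly on $\mathcal{D}$ (in the usual sense for real-valued functions) to the zero function, where for $x\in\mathcal{D}$, $F_{j,\epsilon}(x)=d_j(\{n\in\mathbb{N}:|\wp(f_n(x),f(x))-\wp(f(x),f(x))|\ge\epsilon\})$ and $H_{j,\epsilon}(x)=d_j(\{n\in\mathbb{N}:|\wp(f_n(x),f_n(x))-\wp(f(x),f(x))|\ge\epsilon\})$. *)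

theory Defs
  imports "HOL-Analysis.Analysis"
begin

locale partial_metric_space =
  fixes X :: "'a set" and p :: "'a \<Rightarrow> 'a \<Rightarrow> real"
  assumes nonempty: "X \<noteq> {}"
    and eq_iff: "\<And>x y. x \<in> X \<Longrightarrow> y \<in> X \<Longrightarrow> x = y \<longleftrightarrow> p x x = p x y \<and> p x y = p y y"
    and self_nonneg: "\<And>x. x \<in> X \<Longrightarrow> 0 \<le> p x x"
    and self_le: "\<And>x y. x \<in> X \<Longrightarrow> y \<in> X \<Longrightarrow> p x x \<le> p x y"
    and sym: "\<And>x y. x \<in> X \<Longrightarrow> y \<in> X \<Longrightarrow> p x y = p y x"
    and triangle: "\<And>x y z. x \<in> X \<Longrightarrow> y \<in> X \<Longrightarrow> z \<in> X \<Longrightarrow> p x y \<le> p x z + p z y - p z z"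

text \<open>
  Natural numbers start at 1 here: sequences are indexed by \<open>{1..}\<close> and the
  value of a sequence at index 0 plays no role. The partial density at \<open>j = 0\<close> is the
  junk value 0, which does not affect limits in \<open>j\<close>.
\<close>

definition partial_density :: "nat \<Rightarrow> nat set \<Rightarrow> real" where
  "partial_density j A = real (card (A \<inter> {1..j})) / real j"

definition has_natural_density :: "nat set \<Rightarrow> real \<Rightarrow> bool" where
  "has_natural_density A d \<longleftrightarrow> (\<lambda>j. partial_density j A) \<longlonglongrightarrow> d"

definition stat_uniformly_convergent ::
    "('a \<Rightarrow> 'a \<Rightarrow> real) \<Rightarrow> 'd set \<Rightarrow> (nat \<Rightarrow> 'd \<Rightarrow> 'a) \<Rightarrow> ('d \<Rightarrow> 'a) \<Rightarrow> bool" where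
  "stat_uniformly_convergent p D f g \<longleftrightarrow>
     (\<forall>\<epsilon>>0. \<exists>A \<subseteq> {1..}. has_natural_density A 0 \<and>
        (\<forall>n \<in> {1..} - A. \<forall>x \<in> D.
           \<bar>p (f n x) (g x) - p (g x) (g x)\<bar> < \<epsilon> \<and>
           \<bar>p (f n x) (f n x) - p (g x) (g x)\<bar> < \<epsilon>))"

definition equi_stat_convergent ::
    "('a \<Rightarrow> 'a \<Rightarrow> real) \<Rightarrow> 'd set \<Rightarrow> (nat \<Rightarrow> 'd \<Rightarrow> 'a) \<Rightarrow> ('d \<Rightarrow> 'a) \<Rightarrow> bool" where
  "equi_stat_convergent p D f g \<longleftrightarrow>
     (\<forall>\<epsilon>>0.
        uniform_limit D
          (\<lambda>j x. partial_density j {n \<in> {1..}. \<bar>p (f n x) (g x) - p (g x) (g x)\<bar> \<ge> \<epsilon>})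
          (\<lambda>x. 0) sequentially \<and>
        uniform_limit D
          (\<lambda>j x. partial_density j {n \<in> {1..}. \<bar>p (f n x) (f n x) - p (g x) (g x)\<bar> \<ge> \<epsilon>})
          (\<lambda>x. 0) sequentially)"

end

theory Submission
  imports Defs
begin

text \<open>For fixed \<epsilon>, statistical uniform convergence supplies one exceptional set A of
  density zero that serves all points x at once. Hence, for every x, both sets of bad indices lie in
  A, and their partial densities are squeezed between 0 and d_j(A) by
  \<open>partial_density_mono\<close>. This bound tends to 0 and does not depend on x, which is
  uniform convergence; \<open>uniform_limit_partial_density_zero\<close> isolates this
  argument.\<close>

lemma partial_density_nonneg: "0 \<le> partial_density j A"
  by (simp add: partial_density_def)

lemma partial_density_mono:
  assumes "A \<subseteq> B"
  shows "partial_density j A \<le> partial_density j B"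
proof -
  \<comment> \<open>Truncation to \<open>{1..j}\<close> keeps both sets finite, so cardinality is
    monotone even when B is infinite.\<close>
  have "card (A \<inter> {1..j}) \<le> card (B \<inter> {1..j})"
    using assms by (intro card_mono) auto
  then show ?thesis
    by (simp add: partial_density_def divide_right_mono)
qed

text \<open>The threshold for j comes from A alone, so the same one works for every x. The family B
  stands for either kind of bad index set.\<close>

lemma uniform_limit_partial_density_zero:
  assumes "has_natural_density A 0"
    and "\<And>x. x \<in> D \<Longrightarrow> B x \<subseteq> A"
  shows "uniform_limit D (\<lambda>j x. partial_density j (B x)) (\<lambda>x. 0) sequentially"
proof (rule uniform_limitI)
  fix e :: real
  assume "e > 0"
  then have "\<forall>\<^sub>F j in sequentially. partial_density j A < e"
    using assms(1) unfolding has_natural_density_def by (auto dest: order_tendstoD(2))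
  then show "\<forall>\<^sub>F j in sequentially. \<forall>x\<in>D. dist (partial_density j (B x)) 0 < e"
  proof eventually_elim
    case (elim j)
    have "partial_density j (B x) < e" if "x \<in> D" for x
      using partial_density_mono[OF assms(2)[OF that]] elim by (rule le_less_trans)
    then show ?case
      by (simp add: partial_density_nonneg)
  qed
qed

theorem theorem5p1:
  fixes X :: "'a set" and p :: "'a \<Rightarrow> 'a \<Rightarrow> real"
    and D :: "'d set"
    and f :: "nat \<Rightarrow> 'd \<Rightarrow> 'a" and g :: "'d \<Rightarrow> 'a"
  assumes "partial_metric_space X p"
    and "D \<noteq> {}"
    and "\<And>n. n \<ge> 1 \<Longrightarrow> f n \<in> D \<rightarrow> X"
    and "g \<in> D \<rightarrow> X"
    and "stat_uniformly_convergent p D f g"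
  shows "equi_stat_convergent p D f g"
  unfolding equi_stat_convergent_def
proof (intro allI impI)
  fix \<epsilon> :: real
  assume "\<epsilon> > 0"
  then obtain A where A: "has_natural_density A 0"
    and close: "\<And>n x. n \<in> {1..} - A \<Longrightarrow> x \<in> D \<Longrightarrow>
      \<bar>p (f n x) (g x) - p (g x) (g x)\<bar> < \<epsilon> \<and> \<bar>p (f n x) (f n x) - p (g x) (g x)\<bar> < \<epsilon>"
    using assms(5) unfolding stat_uniformly_convergent_def by meson
  show "uniform_limit D
          (\<lambda>j x. partial_density j {n \<in> {1..}. \<bar>p (f n x) (g x) - p (g x) (g x)\<bar> \<ge> \<epsilon>})
          (\<lambda>x. 0) sequentially \<and>
        uniform_limit D
          (\<lambda>j x. partial_density j {n \<in> {1..}. \<bar>p (f n x) (f n x) - p (g x) (g x)\<bar> \<ge> \<epsilon>})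
          (\<lambda>x. 0) sequentially"
    \<comment> \<open>Contrapositive of \<open>close\<close>: an index n \<ge> 1 at which a
      deviation reaches \<epsilon> cannot lie outside A.\<close>
    using close by (intro conjI uniform_limit_partial_density_zero[OF A]) force+
qed

end
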